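(* Let $D_3:=\{\{1,2,3\},\{-1,-2,-3\},\{-1,2\},\{-2,3\},\{-3,1\}\}$. For $m\in\mathbb{N}$ define $K_m$ recursively: $K_1:=D_3$; $K_{m+1}$ is obtained by taking a copy $F'$ of $D_3$ (obtained by renaming variables) with $\mathrm{var}(F')\cap\mathrm{var}(K_m)=\emptyset$, a new variable $v\notin \mathrm{var}(K_m)\cup\mathrm{var}(F')$, and setting $K_{m+1}:=\{\{v\}\cup D: D\in K_m\}\cup\{\{\overline v\}\cup D: D\in F'\}$. Then $K_m$ is a nonsingular unsatisfiable hitting clause-set with $\delta(K_m)=m+1$ and $n(K_m)=3+(m-1)\cdot 4$. Consequently $\mathrm{N}(k)\ge 4k-5$ for all integers $k\ge 2$.
   Context: Variables are positive integers, literals are nonzero integers, the complement of $x$ is $\overline{x}=-x$. A clause is a finite set of literals with no pair $x,\overline{x}$; a clause-set is a finite set of clauses. $\mathrm{var}(F)$ is the set of variables occurring in $F$, $n(F)=|\mathrm{var}(F)|$, $c(F)=|F|$, $\delta(F)=c(F)-n(F)$. $F$ is satisfiable if some clause meets every clause of $F$, otherwise unsatisfiable. $F$ is hitting if any two distinct clauses $C,D\in F$ have some $x\in C$ with $\overline{x}\in D$. $\mathrm{ldeg}_F(x)$ is the number of clauses of $F$ containing $x$; a variable $v$ of $F$ is singular if $\min(\mathrm{ldeg}_F(v),\mathrm{ldeg}_F(\overline v))=1$; $F$ is nonsingular if it has no singular variables. $\mathrm{N}(k)\in\mathbb{N}_0\cup\{+\infty\}$ is the supremum of $n(F)$ over nonsingular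 unsatisfiable hitting clause-sets $F$ with $\delta(F)=k$. *)

theory Defs
  imports Main "HOL-Library.Extended_Nat"
begin

type_synonym clause = "int set"
type_synonym clause_set = "int set set"

definition is_clause :: "clause \<Rightarrow> bool" where
  "is_clause C \<longleftrightarrow> finite C \<and> 0 \<notin> C \<and> (\<forall>x\<in>C. - x \<notin> C)"

definition is_clause_set :: "clause_set \<Rightarrow> bool" where
  "is_clause_set F \<longleftrightarrow> finite F \<and> (\<forall>C\<in>F. is_clause C)"

definition var :: "clause_set \<Rightarrow> int set" where
  "var F = abs ` \<Union>F"

definition nvar :: "clause_set \<Rightarrow> nat" where
  "nvar F = card (var F)"

definition deficiency :: "clause_set \<Rightarrow> int" where
  "deficiency F = int (card F) - int (nvar F)"

definition satisfiable :: "clause_set \<Rightarrow> bool" where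
  "satisfiable F \<longleftrightarrow> (\<exists>C. is_clause C \<and> (\<forall>D\<in>F. C \<inter> D \<noteq> {}))"

definition hitting :: "clause_set \<Rightarrow> bool" where
  "hitting F \<longleftrightarrow> (\<forall>C\<in>F. \<forall>D\<in>F. C \<noteq> D \<longrightarrow> (\<exists>x\<in>C. - x \<in> D))"

definition ldeg :: "clause_set \<Rightarrow> int \<Rightarrow> nat" where
  "ldeg F x = card {C \<in> F. x \<in> C}"

definition singular_var :: "clause_set \<Rightarrow> int \<Rightarrow> bool" where
  "singular_var F v \<longleftrightarrow> v \<in> var F \<and> min (ldeg F v) (ldeg F (- v)) = 1"

definition nonsingular :: "clause_set \<Rightarrow> bool" where
  "nonsingular F \<longleftrightarrow> (\<nexists>v. singular_var F v)"

definition nonsing_unsat_hitting :: "clause_set \<Rightarrow> bool" where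
  "nonsing_unsat_hitting F \<longleftrightarrow>
     is_clause_set F \<and> nonsingular F \<and> \<not> satisfiable F \<and> hitting F"

definition N :: "int \<Rightarrow> enat" where
  "N k = Sup {enat (nvar F) | F. nonsing_unsat_hitting F \<and> deficiency F = k}"

text \<open>A renaming \<open>f\<close> of variables (positive integers) acts on literals by commuting
  with complementation.\<close>

definition rename_lit :: "(int \<Rightarrow> int) \<Rightarrow> int \<Rightarrow> int" where
  "rename_lit f x = (if x > 0 then f x else - f (- x))"

definition renamed_copy :: "clause_set \<Rightarrow> clause_set \<Rightarrow> bool" where
  "renamed_copy F F' \<longleftrightarrow>
     (\<exists>f. inj_on f (var F) \<and> (\<forall>v\<in>var F. f v > 0) \<and> F' = (\<lambda>C. rename_lit f ` C) ` F)"

definition D3 :: clause_set where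
  "D3 = {{1, 2, 3}, {-1, -2, -3}, {-1, 2}, {-2, 3}, {-3, 1}}"

text \<open>The copy of \<open>D3\<close> and the new variable are arbitrary in every step, so the
  construction is rendered as a relation: \<open>is_K m K\<close> says that \<open>K\<close> is a possible
  outcome for \<open>K\<^sub>m\<close>.\<close>

inductive is_K :: "nat \<Rightarrow> clause_set \<Rightarrow> bool" where
  base: "is_K 1 D3"
| step: "is_K (m + 1) (insert v ` K \<union> insert (- v) ` F')"
    if "is_K m K" "renamed_copy D3 F'" "var F' \<inter> var K = {}"
       "v > 0" "v \<notin> var K \<union> var F'"

lemma is_K_finite_var: "is_K m K \<Longrightarrow> finite (var K)"
proof (induction rule: is_K.induct)
  case base
  show ?case by (simp add: var_def D3_def)
next
  case (step m K F' v)
  have "finite (var F')"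
    using step.hyps(2) by (auto simp: renamed_copy_def var_def D3_def)
  moreover have "var (insert v ` K \<union> insert (- v) ` F') \<subseteq> {\<bar>v\<bar>} \<union> var K \<union> var F'"
    by (auto simp: var_def)
  ultimately show ?case
    using step.IH by (meson finite.emptyI finite_UnI finite_insert finite_subset)
qed

lemma is_K_exists:
  assumes "m \<ge> 1"
  shows "\<exists>K. is_K m K"
  using assms
proof (induction m rule: nat_induct_at_least)
  case base
  show ?case using is_K.base by blast
next
  case (Suc m)
  then obtain K where K: "is_K m K" by blast
  define M where "M = Max (insert 0 (var K))"
  have fin: "finite (insert 0 (var K))" using is_K_finite_var[OF K] by simp
  have M: "x \<le> M" if "x \<in> var K" for x
    unfolding M_def using fin that by (intro Max_ge) auto
  have M0: "M \<ge> 0" unfolding M_def using fin by (intro Max_ge) auto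
  have v3: "var D3 = {1, 2, 3}" by (auto simp: var_def D3_def)
  define F' where "F' = (\<lambda>C. rename_lit (\<lambda>x. x + M) ` C) ` D3"
  have copy: "renamed_copy D3 F'"
    unfolding renamed_copy_def F'_def using M0 v3
    by (intro exI[of _ "\<lambda>x. x + M"]) (auto simp: inj_on_def)
  have vF': "var F' = {M + 1, M + 2, M + 3}"
    using M0 by (auto simp: F'_def D3_def var_def rename_lit_def)
  have "is_K (m + 1) (insert (M + 4) ` K \<union> insert (- (M + 4)) ` F')"
    using M M0 vF' by (intro is_K.step[OF K copy]) force+
  then show ?case by auto
qed

end

theory Submission imports Defs begin

text \<open>Gluing two variable-disjoint clause-sets along a fresh variable \<open>v\<close> preserves unsatisfiability
  (an assignment falsifies \<open>v\<close> or its complement, hence must satisfy one of the two sides) and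
  hitting. It keeps the degrees of all old literals, while \<open>v\<close> and its complement get the numbers of
  clauses of the two sides as degrees; so nonsingularity is preserved as well. Each copy of
  \<open>D3\<close> has 5 clauses and 3 variables and the new variable costs one more, so every step increases
  the deficiency by 1 and the number of variables by 4.\<close>

section \<open>Gluing along a fresh variable\<close>

definition glue :: "int \<Rightarrow> clause_set \<Rightarrow> clause_set \<Rightarrow> clause_set" where
  "glue v F G = insert v ` F \<union> insert (- v) ` G"

text \<open>Since \<open>v\<close> may be any nonzero literal, facts about the \<open>F\<close> side
  carry over to the \<open>G\<close> side by passing to \<open>- v\<close>.\<close>

lemma glue_swap: "glue v F G = glue (- v) G F"
  by (auto simp: glue_def)

lemma abs_in_var: "C \<in> F \<Longrightarrow> x \<in> C \<Longrightarrow> \<bar>x\<bar> \<in> var F"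
  by (auto simp: var_def)

lemma card_insert_image:
  assumes "v \<notin> \<Union>F"
  shows "card (insert v ` F) = card F"
  by (rule card_image) (use assms in \<open>auto simp: inj_on_def dest: insert_ident\<close>)

lemma var_glue: "F \<noteq> {} \<Longrightarrow> var (glue v F G) = insert \<bar>v\<bar> (var F \<union> var G)"
  by (auto simp: var_def glue_def image_Union)

lemma finite_var: "is_clause_set F \<Longrightarrow> finite (var F)"
  by (auto simp: is_clause_set_def is_clause_def var_def)

context
  fixes v :: int and F G :: clause_set
  assumes v_nonzero: "v \<noteq> 0" and fresh_F: "\<bar>v\<bar> \<notin> var F" and fresh_G: "\<bar>v\<bar> \<notin> var G"
begin

lemma fresh_literals:
  assumes "C \<in> F \<union> G"
  shows "v \<notin> C" "- v \<notin> C"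
  using assms abs_in_var[of C F v] abs_in_var[of C G v] abs_in_var[of C F "- v"]
    abs_in_var[of C G "- v"] fresh_F fresh_G by auto

lemma card_glue:
  assumes "finite F" "finite G"
  shows "card (glue v F G) = card F + card G"
proof -
  have "insert v ` F \<inter> insert (- v) ` G = {}"
  proof -
    have "insert v C \<noteq> insert (- v) D" if "C \<in> F" for C D
    proof
      assume "insert v C = insert (- v) D"
      \<comment> \<open>As \<open>v\<close> is nonzero, \<open>- v\<close> differs from
        \<open>v\<close>, so it would have to lie in \<open>C\<close>, against freshness.\<close>
      then have "- v \<in> insert v C" by simp
      with fresh_literals[of C] that v_nonzero show False by simp
    qed
    then show ?thesis by blast
  qed
  moreover have "card (insert v ` F) = card F" "card (insert (- v) ` G) = card G"
    using fresh_literals by (auto intro!: card_insert_image)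
  ultimately show ?thesis
    unfolding glue_def using assms by (simp add: card_Un_disjoint)
qed

lemma ldeg_glue_new: "ldeg (glue v F G) v = card F"
proof -
  have "{C \<in> glue v F G. v \<in> C} = insert v ` F"
    using fresh_literals v_nonzero by (auto simp: glue_def)
  then show ?thesis
    using fresh_literals by (simp add: ldeg_def card_insert_image)
qed

text \<open>The clauses containing \<open>x\<close> all come from the \<open>F\<close> side, and
  inserting the fresh literal \<open>v\<close> keeps them distinct.\<close>

lemma ldeg_glue_old:
  assumes "\<bar>x\<bar> \<noteq> \<bar>v\<bar>" "\<bar>x\<bar> \<notin> var G"
  shows "ldeg (glue v F G) x = ldeg F x"
proof -
  have "{C \<in> glue v F G. x \<in> C} = insert v ` {C \<in> F. x \<in> C}"
    using assms abs_in_var[of _ G x] by (auto simp: glue_def)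
  then show ?thesis
    using fresh_literals by (simp add: ldeg_def card_insert_image)
qed

lemma is_clause_set_glue:
  assumes "is_clause_set F" "is_clause_set G"
  shows "is_clause_set (glue v F G)"
proof -
  have "is_clause (insert v C)" if "C \<in> F" for C
    using assms(1) fresh_literals[of C] that v_nonzero
    by (auto simp: is_clause_set_def is_clause_def minus_equation_iff)
  moreover have "is_clause (insert (- v) C)" if "C \<in> G" for C
    using assms(2) fresh_literals[of C] that v_nonzero
    by (auto simp: is_clause_set_def is_clause_def)
  ultimately show ?thesis
    using assms by (auto simp: is_clause_set_def glue_def)
qed

lemma unsatisfiable_glue:
  assumes "\<not> satisfiable F" "\<not> satisfiable G"
  shows "\<not> satisfiable (glue v F G)"
proof
  assume "satisfiable (glue v F G)"
  then obtain C where C: "is_clause C" and meets: "\<And>D. D \<in> glue v F G \<Longrightarrow> C \<inter> D \<noteq> {}"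
    by (auto simp: satisfiable_def)
  have F: "C \<inter> insert v D \<noteq> {}" if "D \<in> F" for D
    by (rule meets) (use that in \<open>simp add: glue_def\<close>)
  have G: "C \<inter> insert (- v) D \<noteq> {}" if "D \<in> G" for D
    by (rule meets) (use that in \<open>simp add: glue_def\<close>)
  consider "v \<notin> C" | "- v \<notin> C" using C by (auto simp: is_clause_def)
  then show False
  proof cases
    case 1
    with F assms(1) C show False by (auto simp: satisfiable_def)
  next
    case 2
    with G assms(2) C show False by (auto simp: satisfiable_def)
  qed
qed

lemma hitting_glue:
  assumes "hitting F" "hitting G"
  shows "hitting (glue v F G)"
  unfolding hitting_def
proof (intro ballI impI)
  fix A B
  assume "A \<in> glue v F G" "B \<in> glue v F G" and "A \<noteq> B"
  \<comment> \<open>Clauses from the same side inherit their clash from that side; clauses from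
    different sides clash in \<open>v\<close>.\<close>
  then consider
      C D where "C \<in> F" "D \<in> F" "A = insert v C" "B = insert v D" "C \<noteq> D"
    | C D where "C \<in> G" "D \<in> G" "A = insert (- v) C" "B = insert (- v) D" "C \<noteq> D"
    | "v \<in> A" "- v \<in> B" | "- v \<in> A" "v \<in> B"
    by (auto simp: glue_def)
  then show "\<exists>x\<in>A. - x \<in> B"
  proof cases
    case 1 with assms(1) show ?thesis unfolding hitting_def by blast
  next
    case 2 with assms(2) show ?thesis unfolding hitting_def by blast
  next
    case 3 then show ?thesis by blast
  next
    case 4 then show ?thesis by (auto intro: bexI[of _ "- v"])
  qed
qed

end

text \<open>The cardinality bounds are what keeps the new variable from being singular, since its
  two literal degrees are \<open>card F\<close> and \<open>card G\<close>.\<close>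

lemma nonsingular_glue:
  assumes v: "v \<noteq> 0" and fresh: "\<bar>v\<bar> \<notin> var F" "\<bar>v\<bar> \<notin> var G" and disj: "var F \<inter> var G = {}"
    and nonsing: "nonsingular F" "nonsingular G"
    and card: "card F \<ge> 2" "card G \<ge> 2"
  shows "nonsingular (glue v F G)"
  unfolding nonsingular_def
proof
  assume "\<exists>w. singular_var (glue v F G) w"
  then obtain w where w: "w \<in> var (glue v F G)"
    and min: "min (ldeg (glue v F G) w) (ldeg (glue v F G) (- w)) = 1"
    by (auto simp: singular_var_def)
  have "\<bar>w\<bar> = w" using w by (auto simp: var_def)
  have "F \<noteq> {}" using card by auto
  then consider "w = \<bar>v\<bar>" | "w \<in> var F" | "w \<in> var G"
    using w by (auto simp: var_glue)
  then show False
  proof cases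
    case 1
    have "ldeg (glue v F G) v = card F" "ldeg (glue v F G) (- v) = card G"
      using ldeg_glue_new[of v F G] ldeg_glue_new[of "- v" G F] v fresh
      by (simp_all add: glue_swap[of v])
    \<comment> \<open>If \<open>v\<close> is negative, then \<open>w = - v\<close> and the two
      degrees merely trade places in the minimum.\<close>
    with 1 min card show False by (auto simp: abs_if split: if_splits)
  next
    case 2
    then have "\<bar>w\<bar> \<noteq> \<bar>v\<bar>" "\<bar>w\<bar> \<notin> var G" using fresh disj \<open>\<bar>w\<bar> = w\<close> by auto
    then have "ldeg (glue v F G) w = ldeg F w" "ldeg (glue v F G) (- w) = ldeg F (- w)"
      using ldeg_glue_old[OF v fresh] by simp_all
    with 2 min nonsing(1) show False by (auto simp: nonsingular_def singular_var_def)
  next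
    case 3
    then have "\<bar>w\<bar> \<noteq> \<bar>- v\<bar>" "\<bar>w\<bar> \<notin> var F" using fresh disj \<open>\<bar>w\<bar> = w\<close> by auto
    then have "ldeg (glue v F G) w = ldeg G w" "ldeg (glue v F G) (- w) = ldeg G (- w)"
      using ldeg_glue_old[of "- v" G F] v fresh by (simp_all add: glue_swap[of v])
    with 3 min nonsing(2) show False by (auto simp: nonsingular_def singular_var_def)
  qed
qed

lemma nvar_glue:
  assumes "is_clause_set F" "is_clause_set G" "F \<noteq> {}"
    and "\<bar>v\<bar> \<notin> var F" "\<bar>v\<bar> \<notin> var G" "var F \<inter> var G = {}"
  shows "nvar (glue v F G) = nvar F + nvar G + 1"
  using assms finite_var[OF assms(1)] finite_var[OF assms(2)]
  by (simp add: nvar_def var_glue card_Un_disjoint)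

lemma nonsing_unsat_hitting_glue:
  assumes "nonsing_unsat_hitting F" "nonsing_unsat_hitting G"
    and "v \<noteq> 0" "\<bar>v\<bar> \<notin> var F" "\<bar>v\<bar> \<notin> var G" "var F \<inter> var G = {}"
    and "card F \<ge> 2" "card G \<ge> 2"
  shows "nonsing_unsat_hitting (glue v F G)"
  using assms
  by (simp add: nonsing_unsat_hitting_def is_clause_set_glue nonsingular_glue unsatisfiable_glue
      hitting_glue)

section \<open>Copies of \<open>D3\<close> and the iterated construction\<close>

lemma renamed_D3:
  assumes pos: "a > 0" "b > 0" "c > 0" and dist: "a \<noteq> b" "a \<noteq> c" "b \<noteq> c"
    and T: "T = {{a, b, c}, {- a, - b, - c}, {- a, b}, {- b, c}, {- c, a}}"
  shows "nonsing_unsat_hitting T" "card T = 5" "nvar T = 3"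
proof -
  \<comment> \<open>With symbolic variables, the simplifier has to be told that any two of the six
    literals are different.\<close>
  have neg: "- x \<noteq> y" "y \<noteq> - x" if "x > 0" "y > 0" for x y :: int
    using that by auto
  note ne = neg[OF pos(1) pos(1)] neg[OF pos(1) pos(2)] neg[OF pos(1) pos(3)]
    neg[OF pos(2) pos(1)] neg[OF pos(2) pos(2)] neg[OF pos(2) pos(3)]
    neg[OF pos(3) pos(1)] neg[OF pos(3) pos(2)] neg[OF pos(3) pos(3)] dist dist[symmetric]
  have nz: "a \<noteq> 0" "b \<noteq> 0" "c \<noteq> 0" "0 \<noteq> a" "0 \<noteq> b" "0 \<noteq> c" using pos by auto
  have var: "var T = {a, b, c}"
    using pos by (auto simp: T var_def)
  then show "nvar T = 3" using dist by (simp add: nvar_def)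
  have neqs: "{a, b, c} \<noteq> {- a, - b, - c}" "{a, b, c} \<noteq> {- a, b}" "{a, b, c} \<noteq> {- b, c}"
    "{a, b, c} \<noteq> {- c, a}" "{- a, - b, - c} \<noteq> {- a, b}" "{- a, - b, - c} \<noteq> {- b, c}"
    "{- a, - b, - c} \<noteq> {- c, a}" "{- a, b} \<noteq> {- b, c}" "{- a, b} \<noteq> {- c, a}"
    "{- b, c} \<noteq> {- c, a}"
    using ne by (simp_all add: set_eq_subset)
  show "card T = 5" using neqs by (simp add: T)
  have "is_clause_set T"
    using ne nz by (simp add: T is_clause_set_def is_clause_def)
  moreover have "hitting T"
    by (auto simp: T hitting_def)
  \<comment> \<open>The binary clauses form a cycle of implications from \<open>a\<close> to
    \<open>b\<close> to \<open>c\<close> to \<open>a\<close>, so the three variables get equal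
    values; each of the two ternary clauses excludes one value.\<close>
  moreover have "\<not> satisfiable T"
    by (auto simp: T satisfiable_def is_clause_def)
  moreover have "nonsingular T"
  proof -
    \<comment> \<open>This rewrite rule evaluates the filters on the explicit clause list one clause
      at a time.\<close>
    have filter_insert: "{C \<in> insert A S. P C} =
        (if P A then insert A {C \<in> S. P C} else {C \<in> S. P C})" for A :: clause and S P
      by auto
    have "{C \<in> T. a \<in> C} = {{a, b, c}, {- c, a}}" "{C \<in> T. - a \<in> C} = {{- a, - b, - c}, {- a, b}}"
      "{C \<in> T. b \<in> C} = {{a, b, c}, {- a, b}}" "{C \<in> T. - b \<in> C} = {{- a, - b, - c}, {- b, c}}"
      "{C \<in> T. c \<in> C} = {{a, b, c}, {- b, c}}" "{C \<in> T. - c \<in> C} = {{- a, - b, - c}, {- c, a}}"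
      unfolding T filter_insert using ne nz by simp_all
    then have "ldeg T a = 2" "ldeg T (- a) = 2" "ldeg T b = 2" "ldeg T (- b) = 2"
      "ldeg T c = 2" "ldeg T (- c) = 2"
      by (simp_all add: ldeg_def neqs)
    then show ?thesis by (auto simp: nonsingular_def singular_var_def var)
  qed
  ultimately show "nonsing_unsat_hitting T" by (simp add: nonsing_unsat_hitting_def)
qed

lemma renamed_copy_D3:
  assumes "renamed_copy D3 T"
  shows "nonsing_unsat_hitting T" "card T = 5" "nvar T = 3"
proof -
  have "var D3 = {1, 2, 3}" by (auto simp: var_def D3_def)
  with assms obtain f where inj: "inj_on f {1, 2, 3}" and pos: "\<forall>x\<in>{1, 2, 3}. f x > 0"
    and T: "T = (\<lambda>C. rename_lit f ` C) ` D3"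
    by (auto simp: renamed_copy_def)
  have T': "T = {{f 1, f 2, f 3}, {- f 1, - f 2, - f 3}, {- f 1, f 2}, {- f 2, f 3}, {- f 3, f 1}}"
    by (simp add: T D3_def rename_lit_def)
  have "f 1 \<noteq> f 2" "f 1 \<noteq> f 3" "f 2 \<noteq> f 3" using inj by (auto simp: inj_on_def)
  then show "nonsing_unsat_hitting T" "card T = 5" "nvar T = 3"
    using renamed_D3[of "f 1" "f 2" "f 3" T] pos T' by auto
qed

text \<open>Clauses and variables are counted separately because each count is easy to follow
  through gluing; the deficiency is then \<open>5 * m - (4 * m - 1) = m + 1\<close>. Writing
  \<open>nvar K + 1\<close> avoids subtraction on naturals, and \<open>m \<ge> 1\<close> yields the
  bound \<open>card K \<ge> 2\<close> needed for gluing.\<close>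

lemma is_K_properties:
  assumes "is_K m K"
  shows "m \<ge> 1 \<and> nonsing_unsat_hitting K \<and> card K = 5 * m \<and> nvar K + 1 = 4 * m"
  using assms
proof induction
  case base
  show ?case using renamed_D3[of 1 2 3 D3] by (simp add: D3_def)
next
  case (step m K F' v)
  have K: "is_clause_set K" and F': "is_clause_set F'"
    using step.IH renamed_copy_D3(1)[OF step.hyps(2)] by (simp_all add: nonsing_unsat_hitting_def)
  have fresh: "v \<noteq> 0" "\<bar>v\<bar> \<notin> var K" "\<bar>v\<bar> \<notin> var F'" and disj: "var K \<inter> var F' = {}"
    using step.hyps by auto
  have card: "card K \<ge> 2" "card F' \<ge> 2"
    using step.IH renamed_copy_D3(2)[OF step.hyps(2)] by simp_all
  then have "K \<noteq> {}" by auto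
  have "nonsing_unsat_hitting (glue v K F')"
    using step.IH renamed_copy_D3(1)[OF step.hyps(2)] fresh disj card
    by (intro nonsing_unsat_hitting_glue) auto
  moreover have "card (glue v K F') = 5 * (m + 1)"
    using step.IH renamed_copy_D3(2)[OF step.hyps(2)] K F' card_glue[OF fresh]
    by (simp add: is_clause_set_def)
  moreover have "nvar (glue v K F') + 1 = 4 * (m + 1)"
    using step.IH renamed_copy_D3(3)[OF step.hyps(2)] nvar_glue[OF K F' \<open>K \<noteq> {}\<close> fresh(2,3) disj]
    by simp
  ultimately show ?case by (simp add: glue_def)
qed

theorem lemma1:
  "(\<forall>m\<ge>1. \<forall>K. is_K m K \<longrightarrow>
      is_clause_set K \<and> nonsingular K \<and> \<not> satisfiable K \<and> hitting K \<and>
      deficiency K = int m + 1 \<and> int (nvar K) = 3 + (int m - 1) * 4) \<and>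
   (\<forall>k::int. k \<ge> 2 \<longrightarrow> N k \<ge> enat (nat (4 * k - 5)))"
proof -
  have K: "nonsing_unsat_hitting K \<and> deficiency K = int m + 1 \<and> int (nvar K) = 3 + (int m - 1) * 4"
    if "is_K m K" for m K
    using is_K_properties[OF that] by (auto simp: deficiency_def)
  have "N k \<ge> enat (nat (4 * k - 5))" if k: "k \<ge> 2" for k :: int
  proof -
    \<comment> \<open>The index \<open>k - 1\<close> gives deficiency \<open>k\<close> and
      \<open>3 + (k - 2) * 4 = 4 * k - 5\<close> variables; this one witness bounds the supremum
      from below.\<close>
    obtain K where "is_K (nat (k - 1)) K"
    proof -
      have "nat (k - 1) \<ge> 1" using k by linarith
      then show ?thesis using is_K_exists that by blast
    qed
    from K[OF this] k have "nonsing_unsat_hitting K" "deficiency K = k"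
      "nvar K = nat (4 * k - 5)" by auto
    then show ?thesis
      unfolding N_def by (intro Sup_upper CollectI exI[of _ K]) simp
  qed
  with K show ?thesis by (auto simp: nonsing_unsat_hitting_def)
qed

end
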